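(* Let $G=(V,E)$ be a co-chordal graph and let $\mathcal{T}$ be a clique tree of its complement $G^c$. Then the output of $\mathrm{FindPartition}(\mathcal{T})$ (for any choices of edges made during the recursion) is a biclique partition of $G$.
   Context: Graphs are finite and simple; $G$ is co-chordal if $G^c$ is chordal (no induced cycle of length $>3$). A clique tree of a chordal graph $H$ is a tree whose vertices are exactly the maximal cliques of $H$ and which satisfies the clique-intersection property: for any two maximal cliques $K_1,K_2$, every clique on the tree path between $K_1$ and $K_2$ contains $V(K_1)\cap V(K_2)$. For an edge $e=K'K''$ of a clique tree, $\operatorname{mid}(e)=V(K')\cap V(K'')$. A biclique $\{L,R\}$ is the complete bipartite graph with disjoint vertex sets $L,R$ and edge set $\{uv:u\in L,v\in R\}$; a biclique partition of $G$ is a collection of biclique subgraphs of $G$ such that every edge of $G$ lies in exactly one of them. The recursive procedure $\mathrm{FindPartition}(\mathcal{T})$: if $\mathcal{T}$ has at most one vertex, return $\emptyset$; otherwise choose an arbitrary edge $e$ of $\mathcal{T}$, whose removal splits $\mathcal{T}$ into two subtrees $\mathcal{T}_1,\mathcal{T}_2$; set $L=\bigcup_{K\in V(\mathcal{T}_1)}V(K)\setminus\operatorname{mid}(e)$ and $R=\bigcup_{K\in V(\mathcal{T}_2)}V(K)\setminus\operatorname{mid}(e)$; return $\{\{L,R\}\}\cup\mathrm{FindPartition}(\mathcal{T}_1)\cup\mathrm{FindPartition}(\mathcal{T}_2)$. *)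

theory Defs
  imports Main
begin

datatype 'a ugraph = UGraph (uverts: "'a set") (uedges: "'a set set")

definition simple_graph :: "'a ugraph \<Rightarrow> bool" where
  "simple_graph G \<longleftrightarrow>
     finite (uverts G) \<and>
     (\<forall>e\<in>uedges G. \<exists>u v. e = {u, v} \<and> u \<noteq> v \<and> u \<in> uverts G \<and> v \<in> uverts G)"

definition graph_complement :: "'a ugraph \<Rightarrow> 'a ugraph" where
  "graph_complement G =
     UGraph (uverts G)
       {{u, v} | u v. u \<in> uverts G \<and> v \<in> uverts G \<and> u \<noteq> v \<and> {u, v} \<notin> uedges G}"

definition subgraph_of :: "'a ugraph \<Rightarrow> 'a ugraph \<Rightarrow> bool" where
  "subgraph_of H G \<longleftrightarrow> uverts H \<subseteq> uverts G \<and> uedges H \<subseteq> uedges G"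

definition induced_on :: "'a ugraph \<Rightarrow> 'a set \<Rightarrow> 'a ugraph" where
  "induced_on G W = UGraph W {e \<in> uedges G. e \<subseteq> W}"


definition cycle_edges :: "'a list \<Rightarrow> 'a set set" where
  "cycle_edges c = {{c ! i, c ! (Suc i mod length c)} | i. i < length c}"

definition is_cycle :: "'a ugraph \<Rightarrow> 'a list \<Rightarrow> bool" where
  "is_cycle G c \<longleftrightarrow>
     3 \<le> length c \<and> distinct c \<and> set c \<subseteq> uverts G \<and> cycle_edges c \<subseteq> uedges G"

definition induced_cycle :: "'a ugraph \<Rightarrow> 'a list \<Rightarrow> bool" where
  "induced_cycle G c \<longleftrightarrow> is_cycle G c \<and> uedges (induced_on G (set c)) = cycle_edges c"

definition chordal :: "'a ugraph \<Rightarrow> bool" where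
  "chordal G \<longleftrightarrow> \<not> (\<exists>c. induced_cycle G c \<and> 3 < length c)"

definition co_chordal :: "'a ugraph \<Rightarrow> bool" where
  "co_chordal G \<longleftrightarrow> chordal (graph_complement G)"


definition path_between :: "'a ugraph \<Rightarrow> 'a \<Rightarrow> 'a list \<Rightarrow> 'a \<Rightarrow> bool" where
  "path_between G u p v \<longleftrightarrow>
     p \<noteq> [] \<and> hd p = u \<and> last p = v \<and> distinct p \<and> set p \<subseteq> uverts G \<and>
     successively (\<lambda>x y. {x, y} \<in> uedges G) p"

definition is_tree :: "'a ugraph \<Rightarrow> bool" where
  "is_tree T \<longleftrightarrow>
     simple_graph T \<and> uverts T \<noteq> {} \<and>
     (\<forall>u\<in>uverts T. \<forall>v\<in>uverts T. \<exists>p. path_between T u p v) \<and>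
     \<not> (\<exists>c. is_cycle T c)"

definition graph_components :: "'a ugraph \<Rightarrow> 'a ugraph set" where
  "graph_components G =
     {induced_on G {v. \<exists>p. path_between G u p v} | u. u \<in> uverts G}"

definition delete_edge :: "'a ugraph \<Rightarrow> 'a set \<Rightarrow> 'a ugraph" where
  "delete_edge G e = UGraph (uverts G) (uedges G - {e})"


text \<open>A clique is identified with its vertex set.\<close>

definition is_clique :: "'a ugraph \<Rightarrow> 'a set \<Rightarrow> bool" where
  "is_clique G K \<longleftrightarrow>
     K \<subseteq> uverts G \<and> (\<forall>u\<in>K. \<forall>v\<in>K. u \<noteq> v \<longrightarrow> {u, v} \<in> uedges G)"

definition maximal_cliques :: "'a ugraph \<Rightarrow> 'a set set" where
  "maximal_cliques G =
     {K. is_clique G K \<and> (\<forall>K'. is_clique G K' \<and> K \<subseteq> K' \<longrightarrow> K' = K)}"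

definition clique_tree :: "'a ugraph \<Rightarrow> 'a set ugraph \<Rightarrow> bool" where
  "clique_tree H T \<longleftrightarrow>
     is_tree T \<and> uverts T = maximal_cliques H \<and>
     (\<forall>K1\<in>maximal_cliques H. \<forall>K2\<in>maximal_cliques H. \<forall>p.
        path_between T K1 p K2 \<longrightarrow> (\<forall>K\<in>set p. K1 \<inter> K2 \<subseteq> K))"

text \<open>An edge of a clique tree is a doubleton \<open>{K', K''}\<close>, whose intersection is \<open>K' \<inter> K''\<close>.\<close>

definition mid :: "'a set set \<Rightarrow> 'a set" where
  "mid e = \<Inter> e"


definition biclique :: "'a set \<Rightarrow> 'a set \<Rightarrow> 'a ugraph" where
  "biclique L R = UGraph (L \<union> R) {{u, v} | u v. u \<in> L \<and> v \<in> R}"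

definition biclique_partition :: "'a ugraph \<Rightarrow> 'a ugraph set \<Rightarrow> bool" where
  "biclique_partition G P \<longleftrightarrow>
     (\<forall>B\<in>P. (\<exists>L R. L \<inter> R = {} \<and> B = biclique L R) \<and> subgraph_of B G) \<and>
     (\<forall>e\<in>uedges G. \<exists>!B. B \<in> P \<and> e \<in> uedges B)"


text \<open>
  \<open>find_partition T P\<close>: some sequence of edge choices makes the procedure return \<open>P\<close> on
  input \<open>T\<close>.
\<close>

inductive find_partition :: "'a set ugraph \<Rightarrow> 'a ugraph set \<Rightarrow> bool" where
  stop: "finite (uverts T) \<Longrightarrow> card (uverts T) \<le> 1 \<Longrightarrow> find_partition T {}"
| split: "card (uverts T) > 1 \<Longrightarrow> e \<in> uedges T \<Longrightarrow>
          graph_components (delete_edge T e) = {T1, T2} \<Longrightarrow> T1 \<noteq> T2 \<Longrightarrow>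
          L = \<Union> (uverts T1) - mid e \<Longrightarrow>
          R = \<Union> (uverts T2) - mid e \<Longrightarrow>
          find_partition T1 P1 \<Longrightarrow> find_partition T2 P2 \<Longrightarrow>
          find_partition T ({biclique L R} \<union> P1 \<union> P2)"


text \<open>
  The procedure is total on trees: any edge may be chosen at any stage, and the recursion
  terminates.
\<close>

definition adj_rel :: "'a ugraph \<Rightarrow> ('a \<times> 'a) set" where
  "adj_rel G = {(x, y). {x, y} \<in> uedges G}"

lemma path_imp_rtrancl:
  assumes "path_between G u p v"
  shows "(u, v) \<in> (adj_rel G)\<^sup>*"
proof -
  have "p \<noteq> [] \<Longrightarrow> successively (\<lambda>x y. {x, y} \<in> uedges G) p \<Longrightarrow>
        (hd p, last p) \<in> (adj_rel G)\<^sup>*" for p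
  proof (induction p rule: induct_list012)
    case (3 x y zs)
    then have "(x, y) \<in> adj_rel G" "(y, last (y # zs)) \<in> (adj_rel G)\<^sup>*"
      by (auto simp: adj_rel_def)
    then show ?case by (auto intro: converse_rtrancl_into_rtrancl)
  qed auto
  then show ?thesis using assms by (auto simp: path_between_def)
qed

lemma rtrancl_imp_path:
  assumes "simple_graph G" "u \<in> uverts G" "(u, v) \<in> (adj_rel G)\<^sup>*"
  shows "\<exists>p. path_between G u p v"
  using assms(3)
proof (induction rule: rtrancl_induct)
  case base
  show ?case by (rule exI[of _ "[u]"]) (use assms in \<open>auto simp: path_between_def\<close>)
next
  case (step y z)
  then obtain p where p: "path_between G u p y" by blast
  have yz: "{y, z} \<in> uedges G" using step by (auto simp: adj_rel_def)
  then have z: "z \<in> uverts G" using assms(1) by (auto simp: simple_graph_def doubleton_eq_iff)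
  show ?case
  proof (cases "z \<in> set p")
    case True
    then obtain xs ys where s: "p = xs @ z # ys" by (meson split_list)
    have "path_between G u (xs @ [z]) z"
      using p unfolding s path_between_def
      by (cases xs) (auto simp: successively_append_iff successively_Cons hd_append)
    then show ?thesis by blast
  next
    case False
    have "path_between G u (p @ [z]) z"
      using p yz z False unfolding path_between_def
      by (auto simp: successively_append_iff)
    then show ?thesis by blast
  qed
qed

lemma path_iff:
  assumes "simple_graph G" "u \<in> uverts G"
  shows "(\<exists>p. path_between G u p v) \<longleftrightarrow> (u, v) \<in> (adj_rel G)\<^sup>*"
  using rtrancl_imp_path[OF assms, of v] path_imp_rtrancl[of G u _ v] by metis

lemma adj_rel_rtrancl_sym: "(x, y) \<in> (adj_rel G)\<^sup>* \<Longrightarrow> (y, x) \<in> (adj_rel G)\<^sup>*"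
proof -
  have "sym (adj_rel G)"
    unfolding sym_def adj_rel_def by (simp add: insert_commute)
  then show "(x, y) \<in> (adj_rel G)\<^sup>* \<Longrightarrow> ?thesis" by (rule symD[OF sym_rtrancl])
qed

lemma delete_edge_path_cycle:
  assumes "simple_graph T" "{a, b} \<in> uedges T" "path_between (delete_edge T {a, b}) a p b"
  shows "is_cycle T p"
proof -
  let ?H = "delete_edge T {a, b}"
  have ab: "a \<noteq> b" using assms by (auto simp: simple_graph_def doubleton_eq_iff)
  have p: "p \<noteq> []" "hd p = a" "last p = b" "distinct p" "set p \<subseteq> uverts T"
    and s: "successively (\<lambda>x y. {x, y} \<in> uedges ?H) p"
    using assms by (auto simp: path_between_def delete_edge_def)
  have len: "3 \<le> length p"
  proof (rule ccontr)
    assume "\<not> ?thesis"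
    moreover have "length p \<noteq> 0" using p(1) by simp
    ultimately have "length p = 1 \<or> length p = 2" by linarith
    then show False
    proof
      assume "length p = 1"
      then obtain x where "p = [x]" by (auto simp: length_Suc_conv)
      then show False using p ab by simp
    next
      assume "length p = 2"
      then obtain x y where "p = [x, y]" by (auto simp: length_Suc_conv numeral_2_eq_2)
      then show False using p s by (simp add: delete_edge_def)
    qed
  qed
  have "{p ! i, p ! (Suc i mod length p)} \<in> uedges T" if i: "i < length p" for i
  proof (cases "Suc i < length p")
    case True
    then show ?thesis using s by (auto simp: successively_conv_nth delete_edge_def)
  next
    case False
    then have "Suc i = length p" using i by simp
    then have "i = length p - 1" "Suc i mod length p = 0" by simp_all
    then have "p ! i = b" "p ! (Suc i mod length p) = a"
      using p last_conv_nth[OF p(1)] hd_conv_nth[OF p(1)] by simp_all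
    then show ?thesis using assms(2) by (simp add: insert_commute)
  qed
  then show ?thesis using p len by (auto simp: is_cycle_def cycle_edges_def)
qed

lemma component_tree:
  assumes H: "simple_graph H" "\<not> (\<exists>c. is_cycle H c)" and u: "u \<in> uverts H"
  shows "is_tree (induced_on H {v. \<exists>p. path_between H u p v})" (is "is_tree ?C")
proof -
  define W where "W = {v. \<exists>p. path_between H u p v}"
  have W: "W = {v. (u, v) \<in> (adj_rel H)\<^sup>*}" using path_iff[OF H(1) u] by (simp add: W_def)
  have sub: "W \<subseteq> uverts H" by (force simp: W_def path_between_def)
  have fin: "finite W" using sub H(1) by (auto simp: simple_graph_def intro: finite_subset)
  have simple: "simple_graph (induced_on H W)"
    using H(1) fin unfolding simple_graph_def induced_on_def by fastforce
  have reach: "(u, v) \<in> (adj_rel (induced_on H W))\<^sup>*" if "(u, v) \<in> (adj_rel H)\<^sup>*" for v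
    using that
  proof (induction rule: rtrancl_induct)
    case (step y z)
    then have "y \<in> W" "z \<in> W" by (auto simp: W)
    then have "(y, z) \<in> adj_rel (induced_on H W)"
      using step(2) by (auto simp: adj_rel_def induced_on_def)
    then show ?case using step.IH by simp
  qed simp
  have "(x, y) \<in> (adj_rel (induced_on H W))\<^sup>*" if "x \<in> W" "y \<in> W" for x y
    using reach[of x] reach[of y] that adj_rel_rtrancl_sym[of u x "induced_on H W"]
    by (auto simp: W)
  then have conn: "\<exists>p. path_between (induced_on H W) x p y" if "x \<in> W" "y \<in> W" for x y
    using rtrancl_imp_path[OF simple] that by (simp add: induced_on_def)
  have "\<not> is_cycle (induced_on H W) c" for c
    using H(2) sub by (fastforce simp: is_cycle_def induced_on_def)
  moreover have "u \<in> W" by (simp add: W)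
  ultimately show ?thesis
    using simple conn unfolding W_def[symmetric] is_tree_def by (auto simp: induced_on_def)
qed

lemma tree_delete_edge_components:
  assumes T: "is_tree T" and e: "e \<in> uedges T"
  obtains T1 T2 where "graph_components (delete_edge T e) = {T1, T2}" "T1 \<noteq> T2"
    "is_tree T1" "is_tree T2" "uverts T1 \<subset> uverts T" "uverts T2 \<subset> uverts T"
proof -
  define H where "H = delete_edge T e"
  have sT: "simple_graph T" and nc: "\<not> (\<exists>c. is_cycle T c)" using T by (auto simp: is_tree_def)
  have vH: "uverts H = uverts T" by (simp add: H_def delete_edge_def)
  have sH: "simple_graph H" using sT by (auto simp: simple_graph_def H_def delete_edge_def)
  have ncH: "\<not> (\<exists>c. is_cycle H c)"
    using nc by (fastforce simp: is_cycle_def H_def delete_edge_def)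
  obtain a b where ab: "e = {a, b}" "a \<noteq> b" "a \<in> uverts T" "b \<in> uverts T"
    using sT e by (auto simp: simple_graph_def)
  define C where "C u = {v. \<exists>p. path_between H u p v}" for u
  have C: "C u = {v. (u, v) \<in> (adj_rel H)\<^sup>*}" if "u \<in> uverts T" for u
    using path_iff[OF sH] that vH by (simp add: C_def)
  have nab: "(a, b) \<notin> (adj_rel H)\<^sup>*"
  proof
    assume "(a, b) \<in> (adj_rel H)\<^sup>*"
    then obtain p where "path_between H a p b" using rtrancl_imp_path[OF sH] ab vH by blast
    then show False using delete_edge_path_cycle[OF sT] e nc by (auto simp: H_def ab)
  qed
  have reach: "(a, v) \<in> (adj_rel H)\<^sup>* \<or> (b, v) \<in> (adj_rel H)\<^sup>*" if v: "v \<in> uverts T" for v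
  proof -
    obtain p where "path_between T a p v" using T ab(3) v unfolding is_tree_def by meson
    then have "(a, v) \<in> (adj_rel T)\<^sup>*" by (rule path_imp_rtrancl)
    then show ?thesis
    proof (induction rule: rtrancl_induct)
      case (step y z)
      show ?case
      proof (cases "{y, z} = {a, b}")
        case True
        then have "z = a \<or> z = b" by (auto simp: doubleton_eq_iff)
        then show ?thesis by auto
      next
        case False
        then have "(y, z) \<in> adj_rel H"
          using step(2) by (auto simp: adj_rel_def H_def delete_edge_def ab)
        then show ?thesis using step.IH by (auto intro: rtrancl_into_rtrancl)
      qed
    qed simp
  qed
  have eqC: "C x = C y" if "(x, y) \<in> (adj_rel H)\<^sup>*" "x \<in> uverts T" "y \<in> uverts T" for x y
    using that adj_rel_rtrancl_sym[OF that(1)] by (auto simp: C intro: rtrancl_trans)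
  have "C v = C a \<or> C v = C b" if "v \<in> uverts T" for v
    using reach[OF that] eqC[of a v] eqC[of b v] that ab by auto
  then have "C ` uverts T = {C a, C b}" using ab by auto
  moreover have "graph_components H = induced_on H ` C ` uverts T"
    by (auto simp: graph_components_def C_def vH)
  ultimately have comps: "graph_components H = {induced_on H (C a), induced_on H (C b)}"
    by simp
  have mem: "a \<in> C a" "b \<in> C b" "b \<notin> C a" "a \<notin> C b"
    using nab adj_rel_rtrancl_sym[of b a H] ab by (auto simp: C)
  have sub: "C v \<subseteq> uverts T" for v by (force simp: C_def path_between_def vH)
  show ?thesis
  proof (rule that)
    show "graph_components (delete_edge T e) = {induced_on H (C a), induced_on H (C b)}"
      using comps by (simp add: H_def)
    show "induced_on H (C a) \<noteq> induced_on H (C b)" using mem by (auto simp: induced_on_def)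
    show "is_tree (induced_on H (C a))" "is_tree (induced_on H (C b))"
      unfolding C_def using component_tree[OF sH ncH] ab vH by auto
    show "uverts (induced_on H (C a)) \<subset> uverts T" "uverts (induced_on H (C b)) \<subset> uverts T"
      using sub[of a] sub[of b] mem ab by (auto simp: induced_on_def)
  qed
qed

lemma find_partition_exists:
  assumes "is_tree T"
  shows "\<exists>P. find_partition T P"
  using assms
proof (induction "card (uverts T)" arbitrary: T rule: less_induct)
  case less
  have fin: "finite (uverts T)" using less.prems by (auto simp: is_tree_def simple_graph_def)
  show ?case
  proof (cases "card (uverts T) \<le> 1")
    case True
    then show ?thesis using find_partition.stop fin by blast
  next
    case False
    then obtain u v where uv: "u \<in> uverts T" "v \<in> uverts T" "u \<noteq> v"
      using card_le_Suc0_iff_eq[OF fin] by auto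
    then obtain p where "path_between T u p v" using less.prems unfolding is_tree_def by meson
    then have "(u, v) \<in> (adj_rel T)\<^sup>*" by (rule path_imp_rtrancl)
    then obtain w where "{u, w} \<in> uedges T"
      using uv(3) by (auto elim: converse_rtranclE simp: adj_rel_def)
    then obtain e where e: "e \<in> uedges T" by blast
    obtain T1 T2 where *: "graph_components (delete_edge T e) = {T1, T2}" "T1 \<noteq> T2"
      "is_tree T1" "is_tree T2" "uverts T1 \<subset> uverts T" "uverts T2 \<subset> uverts T"
      using tree_delete_edge_components[OF less.prems e] by blast
    obtain P1 P2 where "find_partition T1 P1" "find_partition T2 P2"
      using less.hyps[OF psubset_card_mono[OF fin]] * by meson
    moreover have "card (uverts T) > 1" using False by simp
    ultimately show ?thesis using find_partition.split[OF _ e *(1,2) refl refl] by blast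
  qed
qed

end

theory Submission
  imports Defs
begin

text \<open>
  For any family of sets, call two points separated if no member of the family contains both.
  The edges of \<open>G\<close> are exactly the pairs separated by the maximal cliques of \<open>G\<^sup>c\<close>, so it suffices
  to show that \<open>find_partition T\<close> partitions the pairs separated by the vertices of \<open>T\<close>, for every
  tree \<open>T\<close> of sets with the clique-intersection property. This statement is inherited by
  subtrees, which allows an induction. If deleting the edge \<open>e\<close> splits \<open>T\<close> into \<open>T\<^sub>1\<close> and \<open>T\<^sub>2\<close>,
  every path from \<open>T\<^sub>1\<close> to \<open>T\<^sub>2\<close> uses \<open>e\<close>, so the unions over the two sides meet exactly in \<open>mid e\<close>,
  which lies in a member of either side. Hence a separated pair is either
  contained in exactly one of the two unions, and separated there, or is an edge of the biclique
  chosen at this step.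
\<close>

section \<open>Separated pairs and the intersection property\<close>

text \<open>Loops are excluded automatically: a point of \<open>\<Union>\<K>\<close> lies in some
  member, which then contains \<open>{u, u}\<close>.\<close>

definition separation_graph :: "'a set set \<Rightarrow> 'a ugraph" where
  "separation_graph \<K> =
     UGraph (\<Union>\<K>) {{u, v} | u v. u \<in> \<Union>\<K> \<and> v \<in> \<Union>\<K> \<and> (\<forall>K\<in>\<K>. \<not> {u, v} \<subseteq> K)}"

text \<open>Stated without maximal cliques, so that it passes to subtrees, whose vertices are only
  some of them.\<close>

definition intersection_property :: "'a set ugraph \<Rightarrow> bool" where
  "intersection_property T \<longleftrightarrow>
     (\<forall>K1 K2 p. path_between T K1 p K2 \<longrightarrow> (\<forall>K\<in>set p. K1 \<inter> K2 \<subseteq> K))"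

lemma uverts_separation_graph [simp]: "uverts (separation_graph \<K>) = \<Union>\<K>"
  by (simp add: separation_graph_def)

lemma uedges_separation_graph_iff:
  "d \<in> uedges (separation_graph \<K>) \<longleftrightarrow>
     (\<exists>u v. d = {u, v}) \<and> d \<subseteq> \<Union>\<K> \<and> (\<forall>K\<in>\<K>. \<not> d \<subseteq> K)"
proof
  assume "d \<in> uedges (separation_graph \<K>)"
  then show "(\<exists>u v. d = {u, v}) \<and> d \<subseteq> \<Union>\<K> \<and> (\<forall>K\<in>\<K>. \<not> d \<subseteq> K)"
    by (auto simp: separation_graph_def)
next
  assume d: "(\<exists>u v. d = {u, v}) \<and> d \<subseteq> \<Union>\<K> \<and> (\<forall>K\<in>\<K>. \<not> d \<subseteq> K)"
  then obtain u v where uv: "d = {u, v}" by blast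
  then have "u \<in> \<Union>\<K>" "v \<in> \<Union>\<K>" "\<forall>K\<in>\<K>. \<not> {u, v} \<subseteq> K" using d by auto
  then show "d \<in> uedges (separation_graph \<K>)"
    unfolding separation_graph_def ugraph.sel uv mem_Collect_eq by metis
qed

lemma path_between_mono:
  assumes "subgraph_of H G" "path_between H u p v"
  shows "path_between G u p v"
  using assms unfolding subgraph_of_def path_between_def
  by (auto intro: successively_mono[where P = "\<lambda>x y. {x, y} \<in> uedges H"])

lemma intersection_property_subgraph:
  "intersection_property T \<Longrightarrow> subgraph_of T' T \<Longrightarrow> intersection_property T'"
  unfolding intersection_property_def using path_between_mono by metis

lemma path_between_join:
  assumes "path_between G u p a" "path_between G b q v" "{a, b} \<in> uedges G"
    "set p \<inter> set q = {}"
  shows "path_between G u (p @ q) v"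
  using assms unfolding path_between_def by (auto simp: successively_append_iff)

section \<open>Gluing the partitions of two families\<close>

text \<open>A pair inside both unions lies in \<open>M\<close>, hence in the members
  \<open>A\<close> and \<open>B\<close>, and is separated by neither family. So pairs separated on
  one side stay separated in the whole family, and the three sets of edges are disjoint.\<close>

lemma biclique_partition_separation_graph_Un:
  assumes P1: "biclique_partition (separation_graph \<K>1) P1"
    and P2: "biclique_partition (separation_graph \<K>2) P2"
    and M: "\<Union>\<K>1 \<inter> \<Union>\<K>2 = M" and A: "A \<in> \<K>1" "M \<subseteq> A" and B: "B \<in> \<K>2" "M \<subseteq> B"
  shows "biclique_partition (separation_graph (\<K>1 \<union> \<K>2))
           ({biclique (\<Union>\<K>1 - M) (\<Union>\<K>2 - M)} \<union> P1 \<union> P2)"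
    (is "biclique_partition ?G ({?B} \<union> P1 \<union> P2)")
proof -
  let ?G1 = "separation_graph \<K>1" and ?G2 = "separation_graph \<K>2"
  have G_iff: "d \<in> uedges ?G \<longleftrightarrow> d \<in> uedges ?G1 \<or> d \<in> uedges ?G2 \<or> d \<in> uedges ?B" for d
  proof
    assume d: "d \<in> uedges ?G"
    then obtain u v where uv: "d = {u, v}" by (auto simp: uedges_separation_graph_iff)
    with d have cov: "u \<in> \<Union>\<K>1 \<union> \<Union>\<K>2" "v \<in> \<Union>\<K>1 \<union> \<Union>\<K>2"
      and sep: "\<forall>K\<in>\<K>1 \<union> \<K>2. \<not> d \<subseteq> K"
      by (auto simp: uedges_separation_graph_iff)
    \<comment> \<open>If neither union contains the pair, each endpoint lies in exactly one union,
      so both avoid \<open>M\<close>.\<close>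
    consider "d \<subseteq> \<Union>\<K>1" | "d \<subseteq> \<Union>\<K>2"
      | "u \<in> \<Union>\<K>1 - M" "v \<in> \<Union>\<K>2 - M" | "v \<in> \<Union>\<K>1 - M" "u \<in> \<Union>\<K>2 - M"
      using cov uv M by auto
    then show "d \<in> uedges ?G1 \<or> d \<in> uedges ?G2 \<or> d \<in> uedges ?B"
    proof cases
      case 1
      then show ?thesis using sep uv unfolding uedges_separation_graph_iff by blast
    next
      case 2
      then show ?thesis using sep uv unfolding uedges_separation_graph_iff by blast
    next
      case 3
      then show ?thesis using uv by (auto simp: biclique_def)
    next
      case 4
      then show ?thesis using uv by (auto simp: biclique_def insert_commute)
    qed
  next
    assume "d \<in> uedges ?G1 \<or> d \<in> uedges ?G2 \<or> d \<in> uedges ?B"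
    then consider "d \<in> uedges ?G1" | "d \<in> uedges ?G2" | "d \<in> uedges ?B" by blast
    then show "d \<in> uedges ?G"
    proof cases
      case 1
      then have d: "\<exists>u v. d = {u, v}" "d \<subseteq> \<Union>\<K>1" "\<forall>K\<in>\<K>1. \<not> d \<subseteq> K"
        by (simp_all add: uedges_separation_graph_iff)
      have "\<not> d \<subseteq> \<Union>\<K>2" using d A M by (metis Int_greatest order_trans)
      then have "\<forall>K\<in>\<K>2. \<not> d \<subseteq> K" by (meson Union_upper order_trans)
      with d show ?thesis by (auto simp: uedges_separation_graph_iff)
    next
      case 2
      then have d: "\<exists>u v. d = {u, v}" "d \<subseteq> \<Union>\<K>2" "\<forall>K\<in>\<K>2. \<not> d \<subseteq> K"
        by (simp_all add: uedges_separation_graph_iff)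
      have "\<not> d \<subseteq> \<Union>\<K>1" using d B M by (metis Int_greatest order_trans)
      then have "\<forall>K\<in>\<K>1. \<not> d \<subseteq> K" by (meson Union_upper order_trans)
      with d show ?thesis by (auto simp: uedges_separation_graph_iff)
    next
      case 3
      then obtain u v where uv: "d = {u, v}" "u \<in> \<Union>\<K>1 - M" "v \<in> \<Union>\<K>2 - M"
        by (auto simp: biclique_def)
      \<comment> \<open>As \<open>M\<close> is the whole intersection, \<open>u\<close> is in no
        member of \<open>\<K>2\<close> and \<open>v\<close> in none of \<open>\<K>1\<close>.\<close>
      then have "\<not> d \<subseteq> K" if "K \<in> \<K>1 \<union> \<K>2" for K
        using that M by blast
      moreover have "d \<subseteq> \<Union>(\<K>1 \<union> \<K>2)" using uv by auto
      ultimately show ?thesis using uv(1) unfolding uedges_separation_graph_iff by blast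
    qed
  qed
  have disj12: "uedges ?G1 \<inter> uedges ?G2 = {}"
    unfolding disjoint_iff uedges_separation_graph_iff
    using A M by (metis Int_greatest order_trans)
  have disjB: "uedges ?B \<inter> uedges ?G1 = {}" "uedges ?B \<inter> uedges ?G2 = {}"
    using M by (auto simp: disjoint_iff uedges_separation_graph_iff biclique_def)
  have sub1: "uedges C \<subseteq> uedges ?G1" if "C \<in> P1" for C
    using that P1 by (auto simp: biclique_partition_def subgraph_of_def)
  have sub2: "uedges C \<subseteq> uedges ?G2" if "C \<in> P2" for C
    using that P2 by (auto simp: biclique_partition_def subgraph_of_def)
  have "\<exists>!C. C \<in> {?B} \<union> P1 \<union> P2 \<and> d \<in> uedges C" if d: "d \<in> uedges ?G" for d
  proof -
    consider "d \<in> uedges ?G1" | "d \<in> uedges ?G2" | "d \<in> uedges ?B"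
      using d unfolding G_iff by blast
    then show ?thesis
    proof cases
      case 1
      then have "\<exists>!C. C \<in> P1 \<and> d \<in> uedges C" using P1 by (auto simp: biclique_partition_def)
      moreover have "d \<notin> uedges ?B" "\<And>C. C \<in> P2 \<Longrightarrow> d \<notin> uedges C"
        using 1 disj12 disjB sub2 by blast+
      ultimately show ?thesis by blast
    next
      case 2
      then have "\<exists>!C. C \<in> P2 \<and> d \<in> uedges C" using P2 by (auto simp: biclique_partition_def)
      moreover have "d \<notin> uedges ?B" "\<And>C. C \<in> P1 \<Longrightarrow> d \<notin> uedges C"
        using 2 disj12 disjB sub1 by blast+
      ultimately show ?thesis by blast
    next
      case 3
      then have "\<And>C. C \<in> P1 \<union> P2 \<Longrightarrow> d \<notin> uedges C"
        using disjB sub1 sub2 by blast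
      then show ?thesis using 3 by blast
    qed
  qed
  moreover have "(\<exists>L R. L \<inter> R = {} \<and> C = biclique L R) \<and> subgraph_of C ?G"
    if C: "C \<in> {?B} \<union> P1 \<union> P2" for C
  proof -
    consider "C = ?B" | "C \<in> P1" | "C \<in> P2" using C by blast
    then show ?thesis
    proof cases
      case 1
      have "(\<Union>\<K>1 - M) \<inter> (\<Union>\<K>2 - M) = {}" using M by blast
      moreover have "uverts ?B \<subseteq> uverts ?G" by (auto simp: biclique_def)
      moreover have "uedges ?B \<subseteq> uedges ?G" using G_iff by (intro subsetI) simp
      ultimately show ?thesis using 1 unfolding subgraph_of_def by metis
    next
      case 2
      then have "\<exists>L R. L \<inter> R = {} \<and> C = biclique L R" "subgraph_of C ?G1"
        using P1 by (auto simp: biclique_partition_def)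
      then show ?thesis using G_iff by (auto simp: subgraph_of_def)
    next
      case 3
      then have "\<exists>L R. L \<inter> R = {} \<and> C = biclique L R" "subgraph_of C ?G2"
        using P2 by (auto simp: biclique_partition_def)
      then show ?thesis using G_iff by (auto simp: subgraph_of_def)
    qed
  qed
  ultimately show ?thesis unfolding biclique_partition_def by (intro conjI[OF ballI ballI])
qed

section \<open>Cutting a tree of sets at an edge\<close>

text \<open>Here \<open>T1\<close> and \<open>T2\<close> are the components named by a given run of
  the procedure, in either order; the ends of \<open>e\<close> are labelled to match.\<close>

lemma tree_delete_edge_split:
  assumes T: "is_tree T" and e: "e \<in> uedges T"
    and comps: "graph_components (delete_edge T e) = {T1, T2}" and ne: "T1 \<noteq> T2"
  obtains A B where "e = {A, B}" "A \<in> uverts T1" "B \<in> uverts T2"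
    "is_tree T1" "is_tree T2" "subgraph_of T1 T" "subgraph_of T2 T"
    "uverts T1 \<inter> uverts T2 = {}" "uverts T1 \<union> uverts T2 = uverts T"
proof -
  define H where "H = delete_edge T e"
  define C where "C u = {v. \<exists>p. path_between H u p v}" for u
  have sT: "simple_graph T" and nc: "\<not> (\<exists>c. is_cycle T c)" using T by (auto simp: is_tree_def)
  have vH: "uverts H = uverts T" by (simp add: H_def delete_edge_def)
  have sH: "simple_graph H" using sT by (auto simp: simple_graph_def H_def delete_edge_def)
  have ncH: "\<not> (\<exists>c. is_cycle H c)"
    using nc by (fastforce simp: is_cycle_def H_def delete_edge_def)
  have C: "C u = {v. (u, v) \<in> (adj_rel H)\<^sup>*}" if "u \<in> uverts T" for u
    using path_iff[OF sH] that vH by (simp add: C_def)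
  have C_sub: "C u \<subseteq> uverts T" for u by (force simp: C_def path_between_def vH)
  have comps_C: "{T1, T2} = (\<lambda>u. induced_on H (C u)) ` uverts T"
    using comps by (auto simp: graph_components_def C_def vH H_def[symmetric])
  then obtain u1 u2 where u1: "u1 \<in> uverts T" "T1 = induced_on H (C u1)"
    and u2: "u2 \<in> uverts T" "T2 = induced_on H (C u2)"
    by (metis (no_types, lifting) imageE insertI1 insertI2)
  have verts: "uverts T1 = C u1" "uverts T2 = C u2" using u1 u2 by (simp_all add: induced_on_def)
  have disj: "C u1 \<inter> C u2 = {}"
  proof (rule ccontr)
    assume "C u1 \<inter> C u2 \<noteq> {}"
    then obtain x where "(u1, x) \<in> (adj_rel H)\<^sup>*" "(u2, x) \<in> (adj_rel H)\<^sup>*"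
      using C u1(1) u2(1) by blast
    then have "(u1, u2) \<in> (adj_rel H)\<^sup>*" "(u2, u1) \<in> (adj_rel H)\<^sup>*"
      by (meson adj_rel_rtrancl_sym rtrancl_trans)+
    then have "C u1 = C u2" using C u1(1) u2(1) by (auto intro: rtrancl_trans)
    then show False using ne u1 u2 by simp
  qed
  have cover: "C u1 \<union> C u2 = uverts T"
  proof
    show "uverts T \<subseteq> C u1 \<union> C u2"
    proof
      fix v assume v: "v \<in> uverts T"
      then have "induced_on H (C v) \<in> {T1, T2}" using comps_C by blast
      then have "C v = C u1 \<or> C v = C u2" using u1 u2 by (auto simp: induced_on_def)
      moreover have "v \<in> C v" using C v by simp
      ultimately show "v \<in> C u1 \<union> C u2" by auto
    qed
  qed (use C_sub in auto)
  obtain a b where ab: "e = {a, b}" "a \<in> uverts T" "b \<in> uverts T"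
    using sT e by (auto simp: simple_graph_def)
  \<comment> \<open>A path from \<open>a\<close> to \<open>b\<close> avoiding \<open>e\<close> would
    close up with \<open>e\<close> to a cycle of \<open>T\<close>.\<close>
  have nab: "(a, b) \<notin> (adj_rel H)\<^sup>*"
  proof
    assume "(a, b) \<in> (adj_rel H)\<^sup>*"
    then obtain p where "path_between H a p b" using rtrancl_imp_path[OF sH] ab vH by blast
    then show False using delete_edge_path_cycle[OF sT] e nc by (auto simp: H_def ab)
  qed
  have "\<not> (a \<in> C u \<and> b \<in> C u)" if "u \<in> uverts T" for u
    using nab C[OF that] by (auto intro: rtrancl_trans adj_rel_rtrancl_sym)
  then have "a \<in> C u1 \<and> b \<in> C u2 \<or> b \<in> C u1 \<and> a \<in> C u2"
    using cover ab u1(1) u2(1) by blast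
  then obtain A B where AB: "e = {A, B}" "A \<in> C u1" "B \<in> C u2"
    using ab by (auto simp: insert_commute)
  have sub: "subgraph_of T1 T" "subgraph_of T2 T"
    using u1 u2 C_sub by (auto simp: subgraph_of_def induced_on_def H_def delete_edge_def)
  have trees: "is_tree T1" "is_tree T2"
    using component_tree[OF sH ncH] u1 u2 vH unfolding C_def by auto
  show ?thesis
    using that[OF AB(1)] AB trees sub disj cover verts by simp
qed

lemma find_partition_separation_graph:
  assumes "find_partition T P" "is_tree T" "intersection_property T"
  shows "biclique_partition (separation_graph (uverts T)) P"
  using assms
proof (induction rule: find_partition.induct)
  case (stop T)
  \<comment> \<open>With at most one vertex, any two points of the union share it, so no pair is
    separated.\<close>
  have "x = y" if "x \<in> uverts T" "y \<in> uverts T" for x y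
    using stop.hyps that card_le_Suc0_iff_eq[of "uverts T"] by auto
  then have "uedges (separation_graph (uverts T)) = {}"
    unfolding separation_graph_def by fastforce
  then show ?case by (simp add: biclique_partition_def)
next
  case (split T e T1 T2 L R P1 P2)
  obtain A B where AB: "e = {A, B}" "A \<in> uverts T1" "B \<in> uverts T2"
    and trees: "is_tree T1" "is_tree T2" and sub: "subgraph_of T1 T" "subgraph_of T2 T"
    and disj: "uverts T1 \<inter> uverts T2 = {}" and cover: "uverts T1 \<union> uverts T2 = uverts T"
    using tree_delete_edge_split[OF split.prems(1) split.hyps(2,3,4)] by metis
  have mid: "mid e = A \<inter> B" by (simp add: mid_def AB)
  \<comment> \<open>Join a path from \<open>K1\<close> to \<open>A\<close> in \<open>T1\<close> and
    one from \<open>B\<close> to \<open>K2\<close> in \<open>T2\<close> across \<open>e\<close>; the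
    intersection property applies to both \<open>A\<close> and \<open>B\<close> on the resulting
    path.\<close>
  have "K1 \<inter> K2 \<subseteq> A \<inter> B" if K: "K1 \<in> uverts T1" "K2 \<in> uverts T2" for K1 K2
  proof -
    obtain p where p: "path_between T1 K1 p A"
      using trees(1) K(1) AB(2) unfolding is_tree_def by blast
    obtain q where q: "path_between T2 B q K2"
      using trees(2) K(2) AB(3) unfolding is_tree_def by blast
    have "set p \<inter> set q = {}" using p q disj unfolding path_between_def by blast
    then have "path_between T K1 (p @ q) K2"
      using path_between_join[OF path_between_mono[OF sub(1) p] path_between_mono[OF sub(2) q]]
        split.hyps(2) AB(1) by simp
    moreover have "A \<in> set p" "B \<in> set q" using p q by (auto simp: path_between_def)
    ultimately show ?thesis
      using split.prems(2) unfolding intersection_property_def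
      by (metis UnCI le_inf_iff set_append)
  qed
  \<comment> \<open>The reverse inclusion holds because \<open>A\<close> is a vertex of
    \<open>T1\<close> and \<open>B\<close> one of \<open>T2\<close>.\<close>
  then have meet: "\<Union>(uverts T1) \<inter> \<Union>(uverts T2) = mid e" using AB mid by blast
  have "biclique_partition (separation_graph (uverts T1 \<union> uverts T2))
      ({biclique (\<Union>(uverts T1) - mid e) (\<Union>(uverts T2) - mid e)} \<union> P1 \<union> P2)"
  proof (rule biclique_partition_separation_graph_Un[OF _ _ meet AB(2) _ AB(3)])
    show "biclique_partition (separation_graph (uverts T1)) P1"
      "biclique_partition (separation_graph (uverts T2)) P2"
      using split.IH trees sub intersection_property_subgraph[OF split.prems(2)] by simp_all
  qed (simp_all add: mid)
  then show ?case using cover split.hyps(5,6) by simp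
qed

section \<open>Maximal cliques of the complement\<close>

lemma clique_subset_maximal_clique:
  assumes "finite (uverts G)" "is_clique G K"
  obtains K' where "K' \<in> maximal_cliques G" "K \<subseteq> K'"
proof -
  have "{K. is_clique G K} \<subseteq> Pow (uverts G)" by (auto simp: is_clique_def)
  then have "finite {K. is_clique G K}" using assms(1) by (meson finite_Pow_iff finite_subset)
  from finite_has_maximal2[OF this, of K] assms(2)
  show ?thesis using that unfolding maximal_cliques_def by auto
qed

text \<open>A pair not adjacent in \<open>G\<close> is a clique of the complement and extends to a
  maximal one; an edge of \<open>G\<close> fits in no such clique.\<close>

lemma separation_graph_maximal_cliques_complement:
  assumes "simple_graph G"
  shows "separation_graph (maximal_cliques (graph_complement G)) = G"
proof -
  let ?H = "graph_complement G"
  let ?\<K> = "maximal_cliques ?H"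
  have fin: "finite (uverts ?H)" using assms by (simp add: graph_complement_def simple_graph_def)
  have edge_H: "{u, v} \<in> uedges ?H \<longleftrightarrow>
      u \<in> uverts G \<and> v \<in> uverts G \<and> u \<noteq> v \<and> {u, v} \<notin> uedges G" for u v
    unfolding graph_complement_def by (auto simp: doubleton_eq_iff insert_commute)
  \<comment> \<open>The case \<open>u = v\<close> is included: singletons are cliques, so the
    maximal cliques cover all vertices.\<close>
  have clique: "is_clique ?H {u, v}" if "u \<in> uverts G" "v \<in> uverts G" "{u, v} \<notin> uedges G" for u v
    using that edge_H unfolding is_clique_def by (auto simp: graph_complement_def insert_commute)
  have loopfree: "{u, u} \<notin> uedges G" for u
    using assms by (auto simp: simple_graph_def doubleton_eq_iff)
  have verts: "\<Union>?\<K> = uverts G"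
  proof
    show "\<Union>?\<K> \<subseteq> uverts G"
      by (auto simp: maximal_cliques_def is_clique_def graph_complement_def)
    show "uverts G \<subseteq> \<Union>?\<K>"
      using clique_subset_maximal_clique[OF fin clique] loopfree by blast
  qed
  have sep: "(\<forall>K\<in>?\<K>. \<not> {u, v} \<subseteq> K) \<longleftrightarrow> {u, v} \<in> uedges G"
    if uv: "u \<in> uverts G" "v \<in> uverts G" for u v
  proof
    show "{u, v} \<in> uedges G" if "\<forall>K\<in>?\<K>. \<not> {u, v} \<subseteq> K"
      using that clique_subset_maximal_clique[OF fin clique[OF uv]] by blast
    show "\<forall>K\<in>?\<K>. \<not> {u, v} \<subseteq> K" if E: "{u, v} \<in> uedges G"
    proof (intro ballI notI)
      fix K assume "K \<in> ?\<K>" "{u, v} \<subseteq> K"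
      moreover have "u \<noteq> v" using E loopfree by auto
      ultimately have "{u, v} \<in> uedges ?H" by (auto simp: maximal_cliques_def is_clique_def)
      then show False using E edge_H by blast
    qed
  qed
  have "uedges (separation_graph ?\<K>) = uedges G"
  proof (rule set_eqI)
    fix d
    have ends: "\<exists>u v. d = {u, v} \<and> u \<in> uverts G \<and> v \<in> uverts G" if "d \<in> uedges G"
      using that assms unfolding simple_graph_def by blast
    show "d \<in> uedges (separation_graph ?\<K>) \<longleftrightarrow> d \<in> uedges G"
    proof
      assume "d \<in> uedges (separation_graph ?\<K>)"
      then obtain u v where "d = {u, v}" "u \<in> uverts G" "v \<in> uverts G" "\<forall>K\<in>?\<K>. \<not> {u, v} \<subseteq> K"
        unfolding uedges_separation_graph_iff verts by auto
      then show "d \<in> uedges G" using sep by blast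
    next
      assume d: "d \<in> uedges G"
      then obtain u v where "d = {u, v}" "u \<in> uverts G" "v \<in> uverts G" using ends by blast
      then show "d \<in> uedges (separation_graph ?\<K>)"
        using d sep unfolding uedges_separation_graph_iff verts by blast
    qed
  qed
  then show ?thesis using verts by (simp add: ugraph.expand)
qed

theorem theorem1:
  fixes G :: "'a ugraph" and T :: "'a set ugraph" and P :: "'a ugraph set"
  assumes "simple_graph G"
    and "co_chordal G"
    and "clique_tree (graph_complement G) T"
    and "find_partition T P"
  shows "biclique_partition G P"
proof -
  have T: "is_tree T" "uverts T = maximal_cliques (graph_complement G)"
    using assms(3) by (auto simp: clique_tree_def)
  \<comment> \<open>The ends of a path in \<open>T\<close> are maximal cliques, as the property in
    \<open>clique_tree\<close> requires.\<close>
  have "K1 \<in> uverts T" "K2 \<in> uverts T" if "path_between T K1 p K2" for K1 p K2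
    using that by (auto simp: path_between_def)
  then have "intersection_property T"
    using assms(3) unfolding intersection_property_def clique_tree_def by metis
  then show ?thesis
    using find_partition_separation_graph[OF assms(4) T(1)] T(2)
      separation_graph_maximal_cliques_complement[OF assms(1)] by simp
qed

end
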